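(* Let $\mathbb{F}$ be a field with $|\mathbb{F}|\leq 3$. Then every automorphism of an infinite-dimensional vector space over $\mathbb{F}$ is the product of three involutions.
   Context: An involution of a vector space $V$ is a linear endomorphism $a$ of $V$ with $a^2=\mathrm{id}_V$ (the identity is allowed). *)

theory Defs
  imports "HOL.Vector_Spaces"
begin

context vector_space
begin

definition infinite_dimensional :: bool
  where "infinite_dimensional \<longleftrightarrow> \<not> (\<exists>B. finite B \<and> independent B \<and> span B = UNIV)"

definition automorphism :: "('b \<Rightarrow> 'b) \<Rightarrow> bool"
  where "automorphism u \<longleftrightarrow> Vector_Spaces.linear scale scale u \<and> bij u"

definition involution :: "('b \<Rightarrow> 'b) \<Rightarrow> bool"
  where "involution a \<longleftrightarrow> Vector_Spaces.linear scale scale a \<and> a \<circ> a = id"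

end

end

theory Submission
  imports Defs Main
begin

text \<open>
  Let \<open>u\<close> be the automorphism; nonzero scalars square to 1. Choose \<open>A\<close> maximal such that
  \<open>A\<close> and \<open>u A\<close> are disjoint with independent union, and put \<open>X = span A\<close>, \<open>Y = u X\<close>.
  Maximality makes every vector outside \<open>X \<oplus> Y\<close> an eigenvector modulo \<open>X \<oplus> Y\<close>, so either
  \<open>X \<oplus> Y\<close> has codimension at most 1 or \<open>u\<close> is a scalar \<open>l\<close> modulo \<open>X \<oplus> Y\<close>.

  Any \<open>v\<close> that agrees with \<open>u\<close> on \<open>X\<close> and with \<open>- u\<close> modulo \<open>Y\<close> differs from \<open>u\<close> by an
  involution on the left. If \<open>A\<close> is infinite, the free \<open>Y\<close>-components are used to make \<open>v\<close>
  conjugate to its inverse under an involution \<open>s\<close>: each vector \<open>w\<close> of a basis of \<open>Y\<close> is sent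
  to a fresh basis vector \<open>f w\<close> plus a correction, with \<open>f w\<close> of higher rank than everything the
  correction involves, and \<open>s\<close> is then forced, and well defined, by recursion on the rank.

  If \<open>A\<close> is finite, \<open>u - l\<close> has finite rank. Splitting off cyclic summands of maximal dimension
  writes the space as a finite sum of cyclic subspaces and a subspace on which \<open>u = l\<close>. On a
  cyclic subspace the same recipe turns the companion matrix into a signed cyclic permutation,
  which a reflection of the cycle conjugates to its inverse.
\<close>

section \<open>Injections into an infinite set that raise a rank\<close>

text \<open>\<open>Y \<union> Z\<close> injects into \<open>Y\<close>, and \<open>Y\<close> is in
  bijection with its product with the naturals. With the natural coordinate as rank, each image can
  be moved to a copy ranked above the finite set \<open>N w\<close>.\<close>

lemma ranked_injection:
  fixes N :: "'a \<Rightarrow> 'a set"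
  assumes Y: "infinite Y" and Z: "finite Z" and N: "\<And>w. finite (N w)"
  obtains f and rank :: "'a \<Rightarrow> nat" where "inj_on f (Y \<union> Z)" "f ` (Y \<union> Z) \<subseteq> Y"
    "\<And>w n. w \<in> Y \<union> Z \<Longrightarrow> n \<in> N w \<Longrightarrow> rank n < rank (f w)"
proof -
  have "ordLeq3 (card_of (Y \<union> Z)) (card_of Y)"
    using Y Z
    by (intro card_of_Un_ordLeq_infinite_Field[OF _ card_of_mono1[OF subset_refl] _ card_of_Card_order])
      (simp_all only: Field_card_of ordLeq3_finite_infinite not_False_eq_True)
  then obtain h where h: "inj_on h (Y \<union> Z)" "h ` (Y \<union> Z) \<subseteq> Y"
    unfolding card_of_ordLeq[symmetric] by blast
  have "ordLeq3 (card_of (UNIV :: nat set)) (card_of Y)"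
    using Y by (simp add: infinite_iff_card_of_nat)
  then have "ordIso2 (card_of (Y \<times> (UNIV :: nat set))) (card_of Y)"
    using Y by (intro conjunct1[OF card_of_Times_infinite]) auto
  then obtain e where e: "bij_betw e (Y \<times> (UNIV :: nat set)) Y"
    unfolding card_of_ordIso[symmetric] by blast
  \<comment> \<open>Off \<open>Y\<close> the value is unspecified but fixed, which suffices: only
    finiteness of \<open>N w\<close> matters for the maximum.\<close>
  define rank where "rank y = snd (inv_into (Y \<times> (UNIV :: nat set)) e y)" for y
  have rank: "rank (e (y, n)) = n" if "y \<in> Y" for y n
    using e that by (simp add: rank_def bij_betw_def)
  define f where "f w = e (h w, Suc (Max (rank ` N w)))" for w
  have hY: "h w \<in> Y" if "w \<in> Y \<union> Z" for w using h that by blast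
  show ?thesis
  proof (rule that[of f rank])
    show "inj_on f (Y \<union> Z)"
    proof (rule inj_onI)
      fix x y assume xy: "x \<in> Y \<union> Z" "y \<in> Y \<union> Z" "f x = f y"
      then have "h x = h y"
        using hY inj_onD[OF bij_betw_imp_inj_on[OF e]] by (fastforce simp: f_def)
      then show "x = y" using inj_onD[OF h(1)] xy by blast
    qed
    show "f ` (Y \<union> Z) \<subseteq> Y"
      using hY bij_betw_imp_surj_on[OF e] by (auto simp: f_def)
    show "rank n < rank (f w)" if "w \<in> Y \<union> Z" "n \<in> N w" for w n
      using that N[of w] hY[OF that(1)] by (simp add: f_def rank less_Suc_eq_le)
  qed
qed

section \<open>Automorphisms over a field with self-inverse nonzero scalars\<close>

locale involutive_scalars_automorphism = vector_space scale
  for scale :: "'a::field \<Rightarrow> 'b::ab_group_add \<Rightarrow> 'b" (infixr "*s" 75) +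
  fixes u :: "'b \<Rightarrow> 'b"
  assumes scalar_square: "l \<noteq> 0 \<Longrightarrow> l * l = (1 :: 'a)"
    and linear_u: "Vector_Spaces.linear scale scale u"
    and bij_u: "bij u"
begin

sublocale endo: vector_space_pair scale scale ..
sublocale u: linear scale scale u by (rule linear_u)

abbreviation lin :: "('b \<Rightarrow> 'b) \<Rightarrow> bool"
  where "lin \<equiv> Vector_Spaces.linear scale scale"

lemma lin_comp: "lin f \<Longrightarrow> lin g \<Longrightarrow> lin (\<lambda>x. f (g x))"
  using Vector_Spaces.linear_compose[of scale scale g scale f] by (simp add: o_def)

lemma lin_inv_u: "lin (inv u)"
proof -
  have "module_hom scale scale (inv u)"
    by (rule endo.bij_module_hom_imp_inv_module_hom)
      (use linear_u bij_u in \<open>simp_all add: module_hom_iff_linear\<close>)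
  then show ?thesis by (simp add: module_hom_iff_linear)
qed

lemma inj_u: "inj u"
  using bij_u by (rule bij_is_inj)

lemma u_inv_u [simp]: "u (inv u p) = p"
  using bij_u by (simp add: bij_is_surj surj_f_inv_f)

lemma inv_u_u [simp]: "inv u (u p) = p"
  using inj_u by simp

lemma lin_in_subspaceI:
  assumes "lin f" "subspace T" "\<And>b. b \<in> B \<Longrightarrow> f b \<in> T" "p \<in> span B"
  shows "f p \<in> T"
proof -
  have "span B \<subseteq> {p. f p \<in> T}"
    using assms by (intro span_minimal endo.linear_subspace_linear_preimage) auto
  then show ?thesis using assms by auto
qed

section \<open>Three involutions on an invariant subspace\<close>

text \<open>An involution of the subspace \<open>S\<close> is represented by a linear map on the
  whole space, unconstrained off \<open>S\<close>; no separate type for subspaces is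
  required.\<close>

definition involutive_on :: "'b set \<Rightarrow> ('b \<Rightarrow> 'b) \<Rightarrow> bool"
  where "involutive_on S g \<longleftrightarrow> lin g \<and> g ` S \<subseteq> S \<and> (\<forall>p\<in>S. g (g p) = p)"

definition three_involutions_on :: "'b set \<Rightarrow> bool"
  where "three_involutions_on S \<longleftrightarrow> (\<exists>a b c. involutive_on S a \<and> involutive_on S b \<and>
    involutive_on S c \<and> (\<forall>p\<in>S. u p = a (b (c p))))"

text \<open>Let \<open>t\<close> be \<open>v\<close> after \<open>inv u\<close>. It fixes
  \<open>Y\<close> pointwise and is \<open>-1\<close> modulo \<open>Y\<close> at \<open>p\<close>,
  so \<open>t (t p + p) = t p + p\<close>, that is, \<open>t (t p) = p\<close>.\<close>

lemma twist_square:
  assumes "lin v" and "\<And>y. y \<in> Y \<Longrightarrow> v (inv u y) = y" and "v (inv u p) + p \<in> Y"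
  shows "v (inv u (v (inv u p))) = p"
proof -
  have "lin (\<lambda>p. v (inv u p))"
    using assms(1) lin_inv_u by (rule lin_comp)
  then have "v (inv u (v (inv u p))) + v (inv u p) = v (inv u (v (inv u p) + p))"
    using endo.linear_add[of "\<lambda>p. v (inv u p)" "v (inv u p)" p] by simp
  also have "\<dots> = v (inv u p) + p"
    by (rule assms(2)[OF assms(3)])
  finally show ?thesis by simp
qed

text \<open>If \<open>v\<close> agrees with \<open>u\<close> on the preimage of \<open>Y\<close> and with \<open>- u\<close> modulo \<open>Y\<close>, then \<open>v \<circ> u\<inverse>\<close>
  is an involution, and \<open>v = s \<circ> (s \<circ> v)\<close> is a product of two further ones.\<close>

lemma three_involutions_onI:
  assumes v: "lin v" "v ` S \<subseteq> S" and s: "lin s" "s ` S \<subseteq> S"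
    and S: "subspace S" "u ` S = S" and Y: "Y \<subseteq> S"
    and vY: "\<And>y. y \<in> Y \<Longrightarrow> v (inv u y) = y"
    and vu: "\<And>p. p \<in> S \<Longrightarrow> v p + u p \<in> Y"
    and vsv: "\<And>p. p \<in> S \<Longrightarrow> v (s (v p)) = s p"
    and ss: "\<And>p. p \<in> S \<Longrightarrow> s (s p) = p"
  shows "three_involutions_on S"
proof -
  define t where "t p = v (inv u p)" for p
  have lt: "lin t"
    unfolding t_def using v(1) lin_inv_u by (rule lin_comp)
  have inv_S: "inv u p \<in> S" if "p \<in> S" for p
    using S(2) that by (metis imageE inv_u_u)
  have tS: "t p \<in> S" if "p \<in> S" for p
    using inv_S[OF that] v(2) unfolding t_def by auto
  have tt: "t (t p) = p" if "p \<in> S" for p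
    unfolding t_def using vu[OF inv_S[OF that]] by (intro twist_square[OF v(1) vY]) auto
  have 1: "involutive_on S t" "involutive_on S s"
    using lt tS tt s ss by (auto simp: involutive_on_def)
  \<comment> \<open>Applying \<open>s\<close> to \<open>v (s (v p)) = s p\<close> gives
    \<open>s (s p) = p\<close> on the right.\<close>
  have 2: "involutive_on S (\<lambda>p. s (v p))"
    using s v vsv ss by (auto simp: involutive_on_def lin_comp)
  have 3: "u p = t (s (s (v p)))" if "p \<in> S" for p
  proof -
    have "u p \<in> S" using S(2) that by blast
    then have "u p = t (t (u p))" by (simp add: tt)
    also have "t (u p) = v p" by (simp add: t_def)
    also have "v p = s (s (v p))"
      using v(2) that by (simp add: ss image_subset_iff)
    finally show ?thesis .
  qed
  show ?thesis
    unfolding three_involutions_on_def using 1 2 3 by blast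
qed

section \<open>Direct sums\<close>

lemma projection_exists:
  assumes S: "subspace S\<^sub>1" "subspace S\<^sub>2" and int: "S\<^sub>1 \<inter> S\<^sub>2 \<subseteq> {0}"
  obtains P where "lin P" "\<And>p. p \<in> S\<^sub>1 \<Longrightarrow> P p = p" "\<And>p. p \<in> S\<^sub>2 \<Longrightarrow> P p = 0"
proof -
  obtain B\<^sub>1 where B\<^sub>1: "B\<^sub>1 \<subseteq> S\<^sub>1" "independent B\<^sub>1" "S\<^sub>1 \<subseteq> span B\<^sub>1"
    by (rule maximal_independent_subset)
  obtain B where B: "B\<^sub>1 \<subseteq> B" "B \<subseteq> B\<^sub>1 \<union> S\<^sub>2" "independent B" "B\<^sub>1 \<union> S\<^sub>2 \<subseteq> span B"
    using maximal_independent_subset_extend[of B\<^sub>1 "B\<^sub>1 \<union> S\<^sub>2"] B\<^sub>1 by auto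
  \<comment> \<open>The \<open>span B\<^sub>1\<close> component of a vector of
    \<open>S\<^sub>2\<close> lies in both subspaces, hence vanishes.\<close>
  have S2: "S\<^sub>2 \<subseteq> span (B - B\<^sub>1)"
  proof
    fix p assume p: "p \<in> S\<^sub>2"
    have "B = B\<^sub>1 \<union> (B - B\<^sub>1)" using B by auto
    then have "p \<in> span (B\<^sub>1 \<union> (B - B\<^sub>1))" using p B(4) by auto
    then obtain x y where xy: "p = x + y" "x \<in> span B\<^sub>1" "y \<in> span (B - B\<^sub>1)"
      unfolding span_Un by auto
    have "y \<in> S\<^sub>2" using span_minimal[of "B - B\<^sub>1" S\<^sub>2] B(2) S xy by auto
    then have "x \<in> S\<^sub>2" using subspace_diff[OF S(2) p] xy(1) by fastforce
    moreover have "x \<in> S\<^sub>1" using span_minimal[OF B\<^sub>1(1)] S xy by auto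
    ultimately show "p \<in> span (B - B\<^sub>1)" using int xy by auto
  qed
  define P where "P = endo.construct B (\<lambda>b. if b \<in> B\<^sub>1 then b else 0)"
  have P: "lin P" unfolding P_def by (rule endo.linear_construct[OF B(3)])
  have "P p = p" if "p \<in> S\<^sub>1" for p
    using B(1) B\<^sub>1(3) that
    by (intro endo.linear_eq_on[OF P linear_ident, of p B\<^sub>1])
      (auto simp: P_def endo.construct_basis[OF B(3)])
  moreover have "P p = 0" if "p \<in> S\<^sub>2" for p
    using S2 that
    by (intro endo.linear_eq_on[OF P endo.linear_zero, of p "B - B\<^sub>1"])
      (auto simp: P_def endo.construct_basis[OF B(3)])
  ultimately show ?thesis using P that by blast
qed

text \<open>The involutions on the two summands are glued blockwise; the projection \<open>P\<close>
  makes the glued maps linear on the whole space.\<close>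

lemma three_involutions_on_sum:
  assumes S: "subspace S\<^sub>1" "subspace S\<^sub>2" "S\<^sub>1 \<inter> S\<^sub>2 \<subseteq> {0}"
    and inv: "three_involutions_on S\<^sub>1" "three_involutions_on S\<^sub>2"
  shows "three_involutions_on {p + q |p q. p \<in> S\<^sub>1 \<and> q \<in> S\<^sub>2}" (is "three_involutions_on ?S")
proof -
  obtain P where P: "lin P" and P1: "\<And>p. p \<in> S\<^sub>1 \<Longrightarrow> P p = p" and P2: "\<And>p. p \<in> S\<^sub>2 \<Longrightarrow> P p = 0"
    using projection_exists[OF S] by blast
  define join where "join f g p = f (P p) + g (p - P p)" for f g :: "'b \<Rightarrow> 'b" and p
  have join: "join f g (p + q) = f p + g q" if "p \<in> S\<^sub>1" "q \<in> S\<^sub>2" for f g p q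
    using that by (simp add: join_def endo.linear_add[OF P] P1 P2)
  have joinI: "involutive_on ?S (join f g)" if "involutive_on S\<^sub>1 f" "involutive_on S\<^sub>2 g" for f g
  proof -
    have "lin (join f g)"
      unfolding join_def using that P unfolding involutive_on_def
      by (intro endo.linear_compose_add lin_comp[of f P] lin_comp[of g "\<lambda>p. p - P p"]
          endo.linear_compose_sub linear_ident) auto
    moreover have "join f g (p + q) \<in> ?S \<and> join f g (join f g (p + q)) = p + q"
      if "p \<in> S\<^sub>1" "q \<in> S\<^sub>2" for p q
    proof -
      have "f p \<in> S\<^sub>1" "g q \<in> S\<^sub>2" "f (f p) = p" "g (g q) = q"
        using that \<open>involutive_on S\<^sub>1 f\<close> \<open>involutive_on S\<^sub>2 g\<close>
        by (auto simp: involutive_on_def)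
      then show ?thesis using that by (auto simp: join)
    qed
    ultimately show ?thesis by (fastforce simp: involutive_on_def)
  qed
  obtain a b c where 1: "involutive_on S\<^sub>1 a" "involutive_on S\<^sub>1 b" "involutive_on S\<^sub>1 c"
    "\<And>p. p \<in> S\<^sub>1 \<Longrightarrow> u p = a (b (c p))"
    using inv(1) unfolding three_involutions_on_def by blast
  obtain a' b' c' where 2: "involutive_on S\<^sub>2 a'" "involutive_on S\<^sub>2 b'" "involutive_on S\<^sub>2 c'"
    "\<And>p. p \<in> S\<^sub>2 \<Longrightarrow> u p = a' (b' (c' p))"
    using inv(2) unfolding three_involutions_on_def by blast
  have "u (p + q) = join a a' (join b b' (join c c' (p + q)))" if "p \<in> S\<^sub>1" "q \<in> S\<^sub>2" for p q
    using that 1 2 by (simp add: join u.add involutive_on_def image_subset_iff)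
  then have "\<forall>p\<in>?S. u p = join a a' (join b b' (join c c' p))" by blast
  then show ?thesis
    unfolding three_involutions_on_def
    using joinI[OF 1(1) 2(1)] joinI[OF 1(2) 2(2)] joinI[OF 1(3) 2(3)] by blast
qed

section \<open>Scalar and cyclic summands\<close>

lemma three_involutions_on_scalar:
  assumes "l \<noteq> 0" "\<And>p. p \<in> S \<Longrightarrow> u p = l *s p" "subspace S"
  shows "three_involutions_on S"
proof -
  have "involutive_on S (\<lambda>p. l *s p)"
    using assms scalar_square by (auto simp: involutive_on_def subspace_scale)
  moreover have "involutive_on S (\<lambda>p. p)"
    by (auto simp: involutive_on_def linear_ident)
  ultimately show ?thesis
    unfolding three_involutions_on_def using assms by (intro exI[of _ "\<lambda>p. l *s p"] exI[of _ "\<lambda>p. p"]) auto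
qed

text \<open>Modulo \<open>?Y\<close> the last basis vector is sent by \<open>u\<close> to
  \<open>r *s e 0\<close>. So \<open>v\<close> may shift the basis cyclically with factor
  \<open>- r\<close> at the wrap-around, and reversing the basis conjugates \<open>v\<close> to its
  inverse because \<open>r * r = 1\<close>.\<close>

lemma three_involutions_on_cyclic:
  fixes x :: 'b and d :: nat
  defines "e \<equiv> \<lambda>i. (u ^^ i) x"
  assumes d: "0 < d" and inj: "inj_on e {..<d}" and ind: "independent (e ` {..<d})"
    and ed: "e d \<in> span (e ` {..<d})"
  shows "three_involutions_on (span (e ` {..<d}))"
proof -
  let ?E = "e ` {..<d}" and ?Y = "span (e ` {1..<d})"
  have ue: "u (e i) = e (Suc i)" for i by (simp add: e_def)
  have E: "?E = insert (e 0) (e ` {1..<d})"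
  proof -
    have "{..<d} = insert 0 {1..<d}" using d by auto
    then show ?thesis by simp
  qed
  obtain r where r: "e d - r *s e 0 \<in> ?Y"
    using ed unfolding E span_breakdown_eq by blast
  have u_span: "u ` span (e ` {..<d - 1}) = ?Y"
  proof -
    have "u ` (e ` {..<d - 1}) = e ` Suc ` {..<d - 1}"
      by (simp add: image_image ue)
    also have "Suc ` {..<d - 1} = {1..<d}"
      using d by (auto simp: image_Suc_lessThan)
    finally have "u ` (e ` {..<d - 1}) = e ` {1..<d}" .
    then show ?thesis by (simp flip: u.span_image)
  qed
  have Yq: "\<exists>q \<in> span (e ` {..<d - 1}). y = u q" if "y \<in> ?Y" for y
    using that unfolding u_span[symmetric] by blast
  \<comment> \<open>Otherwise \<open>e d\<close> lies in \<open>?Y\<close>, the image of the span of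
    the first \<open>d - 1\<close> vectors; injectivity of \<open>u\<close> then puts
    \<open>e (d - 1)\<close> into that span.\<close>
  have r0: "r \<noteq> 0"
  proof
    assume "r = 0"
    then obtain q where q: "q \<in> span (e ` {..<d - 1})" "e d = u q" using r Yq by auto
    then have "u (e (d - 1)) = u q" using d by (simp add: ue)
    then have "e (d - 1) \<in> span (e ` {..<d - 1})" using inj_u q by (simp add: inj_eq)
    moreover have "e ` {..<d - 1} \<subseteq> ?E - {e (d - 1)}"
      using d by (auto dest!: inj_onD[OF inj])
    ultimately show False
      using ind d span_mono unfolding dependent_def by (metis Diff_iff diff_less imageI lessThan_iff subsetD zero_less_one)
  qed
  define v where "v = endo.construct ?E (\<lambda>b. let i = the_inv_into {..<d} e b in
     if Suc i < d then e (Suc i) else - (r *s e 0))"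
  define s where "s = endo.construct ?E (\<lambda>b. e (d - Suc (the_inv_into {..<d} e b)))"
  have lin: "lin v" "lin s"
    unfolding v_def s_def by (rule endo.linear_construct[OF ind])+
  have v_e: "v (e i) = (if Suc i < d then e (Suc i) else - (r *s e 0))" if "i < d" for i
    using that inj by (simp add: v_def endo.construct_basis[OF ind] the_inv_into_f_f)
  have s_e: "s (e i) = e (d - Suc i)" if "i < d" for i
    using that inj by (simp add: s_def endo.construct_basis[OF ind] the_inv_into_f_f)
  have in_E: "e i \<in> span ?E" if "i < d" for i using that by (intro span_base) auto
  have Y_sub: "?Y \<subseteq> span ?E" by (rule span_mono) auto
  have vE: "v (e i) \<in> span ?E" if "i < d" for i
    using that d by (auto simp: v_e intro!: in_E span_neg span_scale)
  show ?thesis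
  proof (rule three_involutions_onI[where v = v and s = s and Y = ?Y])
    show "v ` span ?E \<subseteq> span ?E"
    proof (clarify, rule lin_in_subspaceI[OF lin(1)])
      show "v b \<in> span ?E" if "b \<in> ?E" for b using that vE by auto
    qed auto
    show "s ` span ?E \<subseteq> span ?E"
    proof (clarify, rule lin_in_subspaceI[OF lin(2)])
      show "s b \<in> span ?E" if "b \<in> ?E" for b using that in_E s_e d by auto
    qed auto
    show "u ` span ?E = span ?E"
    proof
      show "u ` span ?E \<subseteq> span ?E"
      proof (clarify, rule lin_in_subspaceI[OF linear_u])
        fix b assume "b \<in> ?E"
        then obtain i where "i < d" "b = e i" by auto
        then show "u b \<in> span ?E" using ed in_E[of "Suc i"] by (cases "Suc i = d") (auto simp: ue)
      qed auto
      have sub: "subspace (u ` span ?E)" by (intro u.subspace_image) auto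
      have Yu: "?Y \<subseteq> u ` span ?E"
        unfolding u_span[symmetric] by (intro image_mono span_mono) auto
      moreover have "e d \<in> u ` span ?E"
        using d in_E[of "d - 1"] ue[of "d - 1"] by (metis Suc_diff_1 diff_less imageI zero_less_one)
      \<comment> \<open>Both \<open>e d\<close> and \<open>?Y\<close> lie in the image, so
        \<open>r *s e 0\<close> does, and dividing by \<open>r\<close> recovers the missing basis
        vector \<open>e 0\<close>.\<close>
      ultimately have "e d - (e d - r *s e 0) \<in> u ` span ?E"
        using r sub by (meson subset_iff subspace_diff)
      then have "r *s e 0 \<in> u ` span ?E" by simp
      then have "inverse r *s (r *s e 0) \<in> u ` span ?E"
        by (rule subspace_scale[OF sub])
      then have "e 0 \<in> u ` span ?E" using r0 by simp
      then have "?E \<subseteq> u ` span ?E" 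
        using Yu span_superset[of "e ` {1..<d}"] unfolding E by auto
      then show "span ?E \<subseteq> u ` span ?E" using sub by (rule span_minimal)
    qed
    show "v (inv u y) = y" if y: "y \<in> ?Y" for y
    proof -
      obtain q where q: "q \<in> span (e ` {..<d - 1})" "y = u q" using Yq[OF y] by blast
      have "v q = u q"
        by (rule endo.linear_eq_on[OF lin(1) linear_u q(1)]) (auto simp: v_e ue)
      then show ?thesis using q by simp
    qed
    show "v p + u p \<in> ?Y" if "p \<in> span ?E" for p
    proof (rule lin_in_subspaceI[where f = "\<lambda>p. v p + u p", OF endo.linear_compose_add[OF lin(1) linear_u] _ _ that])
      fix b assume "b \<in> ?E"
      then obtain i where i: "i < d" "b = e i" by auto
      show "v b + u b \<in> ?Y"
      proof (cases "Suc i < d")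
        case True
        then have "e (Suc i) \<in> ?Y" by (intro span_base) auto
        then show ?thesis using i True by (auto simp: v_e ue intro: span_add)
      next
        case False
        then have "Suc i = d" using i by simp
        then show ?thesis using i r by (simp add: v_e ue)
      qed
    qed auto
    show "v (s (v p)) = s p" if "p \<in> span ?E" for p
    proof (rule endo.linear_eq_on[OF _ lin(2) that])
      show "lin (\<lambda>p. v (s (v p)))" by (rule lin_comp[OF lin(1) lin_comp[OF lin(2,1)]])
      fix b assume "b \<in> ?E"
      then obtain i where i: "i < d" "b = e i" by auto
      show "v (s (v b)) = s b"
      proof (cases "Suc i < d")
        case True
        then show ?thesis using i by (simp add: v_e s_e Suc_diff_Suc)
      next
        case False
        then have "Suc i = d" using i by simp
        then show ?thesis using i d r0 scalar_square[OF r0]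
          by (simp add: v_e s_e endo.linear_neg[OF lin(1)] endo.linear_neg[OF lin(2)]
              endo.linear_scale[OF lin(1)] endo.linear_scale[OF lin(2)])
      qed
    qed
    show "s (s p) = p" if "p \<in> span ?E" for p
      by (rule endo.linear_eq_on[OF lin_comp[OF lin(2) lin(2)] linear_ident that])
        (auto simp: s_e)
  qed (use lin Y_sub in auto)
qed

section \<open>Splitting off a cyclic summand\<close>

text \<open>Independence of the first \<open>k\<close> iterates as a family, in an incremental form
  that includes their distinctness.\<close>

definition chain :: "'b \<Rightarrow> nat \<Rightarrow> bool"
  where "chain x k \<longleftrightarrow> (\<forall>i<k. (u ^^ i) x \<notin> span ((\<lambda>j. (u ^^ j) x) ` {..<i}))"

lemma chain_independent:
  "chain x k \<Longrightarrow> inj_on (\<lambda>i. (u ^^ i) x) {..<k} \<and> independent ((\<lambda>i. (u ^^ i) x) ` {..<k})"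
proof (induction k)
  case (Suc k)
  let ?e = "\<lambda>i. (u ^^ i) x"
  have new: "?e k \<notin> span (?e ` {..<k})" and "chain x k"
    using Suc.prems by (auto simp: chain_def)
  then have "inj_on ?e {..<k}" "independent (?e ` {..<k})" using Suc.IH by auto
  moreover have "?e k \<notin> ?e ` {..<k}" using new by (meson span_base)
  ultimately show ?case using new
    by (simp add: lessThan_Suc independent_insert)
qed (simp add: independent_empty)

lemma lin_power: "lin (u ^^ k)"
proof (induction k)
  case 0
  then show ?case by (simp add: linear_id flip: id_def)
next
  case (Suc k)
  then show ?case using lin_comp[OF linear_u, of "u ^^ k"] by (simp add: o_def)
qed

lemma power_in_subspace: "u ` S \<subseteq> S \<Longrightarrow> p \<in> S \<Longrightarrow> (u ^^ k) p \<in> S"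
  by (induction k) auto

text \<open>Modulo \<open>span B\<close> the map is the scalar \<open>l\<close>, so all iterates of
  \<open>x\<close> stay in the span of \<open>insert x B\<close>. This makes chains of maximal
  length available.\<close>

lemma chain_bound:
  assumes S: "u ` S \<subseteq> S" "x \<in> S"
    and B: "\<And>p. p \<in> S \<Longrightarrow> u p - l *s p \<in> span B" "finite B"
    and "chain x k"
  shows "k \<le> Suc (card B)"
proof -
  let ?e = "\<lambda>i. (u ^^ i) x"
  have "?e i \<in> span (insert x B)" for i
  proof (induction i)
    case 0
    then show ?case by (simp add: span_base)
  next
    case (Suc i)
    have "u (?e i) - l *s ?e i \<in> span (insert x B)"
      using B(1)[OF power_in_subspace[OF S]] span_mono[of B "insert x B"] by blast
    then have "u (?e i) - l *s ?e i + l *s ?e i \<in> span (insert x B)"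
      using Suc by (intro span_add span_scale)
    then show ?case by simp
  qed
  then have "card (?e ` {..<k}) \<le> card (insert x B)"
    using independent_span_bound[of "insert x B" "?e ` {..<k}"] chain_independent[OF assms(5)] B(2)
    by auto
  then show ?thesis
    using chain_independent[OF assms(5)] B(2) by (simp add: card_image card_insert_if split: if_splits)
qed

text \<open>For a chain of maximal length \<open>d\<close> and a functional \<open>\<phi>\<close> dual to its last vector, the
  vectors killed by all \<open>\<phi> \<circ> u\<^sup>i\<close> with \<open>i < d\<close> form an invariant complement: if \<open>\<phi> \<circ> u\<^sup>d\<close> did
  not vanish at such a vector, that vector would start a chain of length \<open>d + 1\<close>.\<close>

lemma cyclic_complement:
  assumes S: "subspace S" "u ` S \<subseteq> S" and x: "x \<in> S" "chain x d" and d: "0 < d"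
    and max: "\<And>y. y \<in> S \<Longrightarrow> \<not> chain y (Suc d)"
  defines "E \<equiv> (\<lambda>i. (u ^^ i) x) ` {..<d}"
  obtains W where "subspace W" "u ` W \<subseteq> W" "W \<subseteq> S" "span E \<inter> W \<subseteq> {0}"
    "S = {p + q |p q. p \<in> span E \<and> q \<in> W}" "(u ^^ d) x \<in> span E"
proof -
  let ?e = "\<lambda>i. (u ^^ i) x"
  have inj: "inj_on ?e {..<d}" and ind: "independent E"
    using chain_independent[OF x(2)] by (auto simp: E_def)
  have ed: "?e d \<in> span E"
    using max[OF x(1)] x(2) unfolding E_def chain_def by (metis less_antisym)
  define \<phi> where "\<phi> p = representation (extend_basis E) p (?e (d - 1))" for p
  have D: "independent (extend_basis E)" "E \<subseteq> extend_basis E"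
    by (rule independent_extend_basis[OF ind], rule extend_basis_superset[OF ind])
  have \<phi>_add: "\<phi> (p + q) = \<phi> p + \<phi> q" and \<phi>_scale: "\<phi> (c *s p) = c * \<phi> p" for p q c
    using D ind by (simp_all add: \<phi>_def representation_add representation_scale)
  have \<phi>_e: "\<phi> (?e i) = (if i = d - 1 then 1 else 0)" if "i < d" for i
  proof -
    have "?e i \<in> extend_basis E" using D(2) that by (auto simp: E_def)
    then show ?thesis
      using that d inj_onD[OF inj, of "d - 1" i]
      by (auto simp: \<phi>_def representation_basis[OF D(1)])
  qed
  have sub: "subspace {q. \<phi> ((u ^^ k) q) = 0}" for k
    using \<phi>_scale[of 0 0]
    by (intro subspaceI) (auto simp: endo.linear_0[OF lin_power] endo.linear_add[OF lin_power]
        endo.linear_scale[OF lin_power] \<phi>_add \<phi>_scale)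
  have killed: "\<phi> ((u ^^ k) q) = 0"
    if "q \<in> span B" "\<And>b. b \<in> B \<Longrightarrow> \<phi> ((u ^^ k) b) = 0" for k q B
    using span_minimal[of B, OF _ sub[of k]] that by auto
  have pow: "(u ^^ k) ((u ^^ i) y) = (u ^^ (k + i)) y" for k i y
    by (simp add: funpow_add)
  define W where "W = {q \<in> S. \<forall>i<d. \<phi> ((u ^^ i) q) = 0}"
  have W: "W = S \<inter> (\<Inter>i\<in>{..<d}. {q. \<phi> ((u ^^ i) q) = 0})" by (auto simp: W_def)
  have subW: "subspace W"
    unfolding W by (intro subspace_inter subspace_Int S sub)
  have uW: "u q \<in> W" if q: "q \<in> W" for q
  proof -
    have "\<phi> ((u ^^ d) q) = 0"
    proof (rule ccontr)
      assume nz: "\<phi> ((u ^^ d) q) \<noteq> 0"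
      \<comment> \<open>Applying \<open>u ^^ (d - i)\<close> moves the iterates before the
        \<open>i\<close>-th to exponents below \<open>d\<close>, where \<open>\<phi>\<close>
        vanishes, but the \<open>i\<close>-th one to exponent \<open>d\<close>.\<close>
      have "(u ^^ i) q \<notin> span ((\<lambda>j. (u ^^ j) q) ` {..<i})" if "i < Suc d" for i
      proof
        assume *: "(u ^^ i) q \<in> span ((\<lambda>j. (u ^^ j) q) ` {..<i})"
        have "\<phi> ((u ^^ (d - i)) ((u ^^ i) q)) = 0"
          by (rule killed[OF *]) (use q that in \<open>auto simp: W_def pow\<close>)
        then show False using nz that by (simp add: pow)
      qed
      then show False using max[of q] q by (simp add: chain_def W_def)
    qed
    moreover have "(u ^^ i) (u q) = (u ^^ Suc i) q" for i by (simp add: funpow_swap1)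
    ultimately have "\<phi> ((u ^^ i) (u q)) = 0" if "i < d" for i
      using q that by (cases "Suc i = d") (auto simp: W_def simp del: funpow.simps)
    then show ?thesis using q S by (auto simp: W_def)
  qed
  \<comment> \<open>The top coefficient is peeled off: \<open>u ^^ (d - 1 - k)\<close> carries
    \<open>?e k\<close> to the vector on which \<open>\<phi>\<close> is 1, and earlier vectors to
    ones on which it is 0.\<close>
  have disjoint: "p = 0" if "k \<le> d" "p \<in> span (?e ` {..<k})" "p \<in> W" for p k
    using that
  proof (induction k)
    case (Suc k)
    obtain a where a: "p - a *s ?e k \<in> span (?e ` {..<k})"
      using Suc.prems(2) by (auto simp: lessThan_Suc span_breakdown_eq)
    have "\<phi> ((u ^^ (d - 1 - k)) (p - a *s ?e k)) = 0"
      by (rule killed[OF a]) (use Suc.prems(1) in \<open>auto simp: pow \<phi>_e\<close>)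
    moreover have "\<phi> ((u ^^ (d - 1 - k)) (a *s ?e k)) = a"
      using Suc.prems(1) d by (simp add: endo.linear_scale[OF lin_power] pow \<phi>_scale \<phi>_e)
    moreover have "\<phi> ((u ^^ (d - 1 - k)) (p - a *s ?e k + a *s ?e k)) = 0"
      using Suc.prems by (simp add: W_def)
    ultimately have "a = 0"
      unfolding endo.linear_add[OF lin_power] \<phi>_add by simp
    then show ?case using Suc a by simp
  qed simp
  \<comment> \<open>A triangular system solved row by row: adding a multiple of
    \<open>?e (d - Suc j)\<close> corrects condition \<open>j\<close> without disturbing conditions
    \<open>i < j\<close>.\<close>
  have approx: "\<exists>c\<in>span E. \<forall>i<j. \<phi> ((u ^^ i) (q - c)) = 0" if "j \<le> d" for j q
    using that
  proof (induction j)
    case 0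
    then show ?case using span_zero by blast
  next
    case (Suc j)
    then obtain c where c: "c \<in> span E" "\<And>i. i < j \<Longrightarrow> \<phi> ((u ^^ i) (q - c)) = 0" by auto
    define a where "a = \<phi> ((u ^^ j) (q - c))"
    define c' where "c' = c + a *s ?e (d - Suc j)"
    have "?e (d - Suc j) \<in> span E"
      using Suc.prems by (intro span_base) (auto simp: E_def)
    then have "c' \<in> span E" using c(1) by (simp add: c'_def span_add span_scale)
    moreover have "\<phi> ((u ^^ i) (q - c')) = 0" if "i < Suc j" for i
    proof -
      have "q - c = (q - c') + a *s ?e (d - Suc j)" by (simp add: c'_def)
      then have "\<phi> ((u ^^ i) (q - c)) = \<phi> ((u ^^ i) (q - c')) + a * \<phi> (?e (i + (d - Suc j)))"
        by (metis endo.linear_add[OF lin_power] endo.linear_scale[OF lin_power] \<phi>_add \<phi>_scale pow)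
      moreover have "\<phi> (?e (i + (d - Suc j))) = (if i = j then 1 else 0)"
        using Suc.prems that by (subst \<phi>_e) auto
      ultimately show ?thesis using c(2)[of i] that by (auto simp: a_def split: if_splits)
    qed
    ultimately show ?case by blast
  qed
  have ES: "span E \<subseteq> S"
    using x(1) S power_in_subspace by (intro span_minimal) (auto simp: E_def)
  have sum: "S = {p + q |p q. p \<in> span E \<and> q \<in> W}"
  proof (intro equalityI subsetI)
    fix q assume q: "q \<in> S"
    obtain c where c: "c \<in> span E" "\<forall>i<d. \<phi> ((u ^^ i) (q - c)) = 0" using approx by blast
    have "q - c \<in> W" using c q ES S by (auto simp: W_def intro: subspace_diff)
    moreover have "q = c + (q - c)" by simp
    ultimately show "q \<in> {p + q |p q. p \<in> span E \<and> q \<in> W}" using c by blast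
  qed (use ES S in \<open>auto simp: W_def intro: subspace_add\<close>)
  have int: "span E \<inter> W \<subseteq> {0}" using disjoint[of d] by (auto simp: E_def)
  have "u ` W \<subseteq> W" using uW by blast
  moreover have "W \<subseteq> S" unfolding W by blast
  ultimately show ?thesis using subW int sum ed by (intro that)
qed

section \<open>Finite-rank perturbations of a scalar\<close>

text \<open>Induction on a bound for the rank of \<open>u - l\<close> on \<open>S\<close>, stated
  through independent subsets of the image. The cyclic summand split off contains a nonzero vector
  of that image, so the bound drops on the complement.\<close>

lemma three_involutions_on_finite_rank:
  assumes l: "l \<noteq> 0" and "subspace S" "u ` S \<subseteq> S"
    and "\<And>B. independent B \<Longrightarrow> B \<subseteq> (\<lambda>p. u p - l *s p) ` S \<Longrightarrow> finite B \<and> card B \<le> n"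
  shows "three_involutions_on S"
  using assms(2-)
proof (induction n arbitrary: S rule: less_induct)
  case (less n)
  note S = less.prems(1,2) and bound = less.prems(3)
  show ?case
  proof (cases "\<forall>p\<in>S. u p = l *s p")
    case True
    then show ?thesis using three_involutions_on_scalar l S by blast
  next
    case False
    then obtain x\<^sub>1 where x\<^sub>1: "x\<^sub>1 \<in> S" "u x\<^sub>1 \<noteq> l *s x\<^sub>1" by blast
    let ?R = "(\<lambda>p. u p - l *s p) ` S"
    obtain B where B: "B \<subseteq> ?R" "independent B" "?R \<subseteq> span B"
      by (rule maximal_independent_subset)
    have "finite B" using bound B by blast
    define K where "K = {k. \<exists>x\<in>S. chain x k}"
    have K: "K \<subseteq> {..Suc (card B)}"
      using chain_bound[OF S(2) _ _ \<open>finite B\<close>] B(3) unfolding K_def by blast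
    have "x\<^sub>1 \<noteq> 0" using x\<^sub>1(2) by auto
    then have "chain x\<^sub>1 1" by (simp add: chain_def)
    then have 1: "1 \<in> K" using x\<^sub>1 by (auto simp: K_def)
    define d where "d = Max K"
    have fin: "finite K" using K finite_subset by blast
    have d: "d \<in> K" "1 \<le> d" using Max_in[OF fin] Max_ge[OF fin] 1 by (auto simp: d_def)
    have max: "\<not> chain y (Suc d)" if "y \<in> S" for y
      using Max_ge[OF fin, of "Suc d"] that by (auto simp: d_def K_def)
    \<comment> \<open>For \<open>d = 1\<close> a maximal chain could start at an eigenvector for
      \<open>l\<close>, and the rank would not drop; \<open>x\<^sub>1\<close> avoids this. For
      \<open>d > 1\<close> the start is no eigenvector.\<close>
    have "\<exists>x\<in>S. chain x d \<and> u x \<noteq> l *s x"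
    proof (cases "d = 1")
      case True
      then show ?thesis using x\<^sub>1 \<open>chain x\<^sub>1 1\<close> by auto
    next
      case False
      obtain x where x: "x \<in> S" "chain x d" using d by (auto simp: K_def)
      then have "(u ^^ 1) x \<notin> span ((\<lambda>j. (u ^^ j) x) ` {..<1})"
        using False d unfolding chain_def by (metis le_neq_implies_less)
      then have "u x \<noteq> l *s x" by (auto simp: span_singleton lessThan_Suc)
      then show ?thesis using x by blast
    qed
    then obtain x where x: "x \<in> S" "chain x d" "u x \<noteq> l *s x" by blast
    define E where "E = (\<lambda>i. (u ^^ i) x) ` {..<d}"
    obtain W where W: "subspace W" "u ` W \<subseteq> W" "W \<subseteq> S" "span E \<inter> W \<subseteq> {0}"
      and SEW: "S = {p + q |p q. p \<in> span E \<and> q \<in> W}" and ed: "(u ^^ d) x \<in> span E"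
      using cyclic_complement[OF S x(1,2) _ max] d unfolding E_def by auto
    have "three_involutions_on (span E)"
      using three_involutions_on_cyclic[of d x] chain_independent[OF x(2)] ed d
      by (simp add: E_def)
    moreover have "three_involutions_on W"
    proof -
      let ?r = "u x - l *s x"
      have "x \<in> span E" using d by (intro span_base) (auto simp: E_def intro!: image_eqI[of _ _ 0])
      moreover have "u x \<in> span E"
      proof (cases "d = 1")
        case False
        then show ?thesis using d by (intro span_base) (auto simp: E_def intro!: image_eqI[of _ _ 1])
      qed (use ed in simp)
      ultimately have r: "?r \<in> span E" "?r \<in> ?R"
        using x by (auto intro: span_diff span_scale)
      \<comment> \<open>Since \<open>?r\<close> is a nonzero element of \<open>span E\<close>, it is
        independent of every \<open>B'\<close> inside \<open>W\<close> and uses up one unit of the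
        bound for \<open>S\<close>.\<close>
      have B': "finite (insert ?r B') \<and> card (insert ?r B') \<le> n \<and> ?r \<notin> B'"
        if "independent B'" "B' \<subseteq> (\<lambda>p. u p - l *s p) ` W" for B'
      proof -
        have "B' \<subseteq> W"
          using that(2) W(1,2) by (auto intro!: subspace_diff subspace_scale)
        then have "span B' \<subseteq> W" using W(1) span_minimal by blast
        then have r': "?r \<notin> span B'" using r(1) W(4) x(3) by auto
        have ind: "independent (insert ?r B')"
          using that(1) r' by (simp add: independent_insertI)
        have sub: "insert ?r B' \<subseteq> ?R" using that(2) W(3) r(2) by auto
        have "?r \<notin> B'" using r' by (meson span_base)
        then show ?thesis
          by (intro conjI bound[OF ind sub, THEN conjunct1] bound[OF ind sub, THEN conjunct2])
      qed
      then have "0 < n" using B'[of "{}"] independent_empty by auto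
      moreover have "finite B' \<and> card B' \<le> n - 1"
        if "independent B'" "B' \<subseteq> (\<lambda>p. u p - l *s p) ` W" for B'
        using B'[OF that] by auto
      ultimately show ?thesis
        using less.IH[of "n - 1" W] W(1,2) by auto
    qed
    ultimately show ?thesis
      using three_involutions_on_sum[OF subspace_span W(1,4)] by (simp flip: SEW)
  qed
qed

section \<open>A maximal independent union of a set and its image\<close>

text \<open>Zorn's lemma: if \<open>w\<close> and \<open>u w\<close> were independent modulo the
  span, \<open>w\<close> could be added to a maximal \<open>A\<close>.\<close>

lemma maximal_disjoint_image:
  obtains A where "A \<inter> u ` A = {}" "independent (A \<union> u ` A)"
    "\<And>w. w \<notin> span (A \<union> u ` A) \<Longrightarrow> \<exists>k. u w - k *s w \<in> span (A \<union> u ` A)"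
proof -
  let ?F = "{A. A \<inter> u ` A = {} \<and> independent (A \<union> u ` A)}"
  have "\<exists>M\<in>?F. \<forall>X\<in>?F. M \<subseteq> X \<longrightarrow> X = M"
  proof (rule subset_Zorn_nonempty)
    show "?F \<noteq> {}" by (auto intro!: exI[of _ "{}"] simp: independent_empty)
    fix C assume C: "C \<noteq> {}" "subset.chain ?F C"
    then have CF: "\<And>A. A \<in> C \<Longrightarrow> A \<in> ?F" and lin: "\<And>A B. A \<in> C \<Longrightarrow> B \<in> C \<Longrightarrow> A \<subseteq> B \<or> B \<subseteq> A"
      by (auto simp: subset_chain_def)
    have "independent (\<Union>((\<lambda>A. A \<union> u ` A) ` C))"
    proof (rule independent_Union_directed)
      fix c d assume "c \<in> (\<lambda>A. A \<union> u ` A) ` C" "d \<in> (\<lambda>A. A \<union> u ` A) ` C"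
      then obtain A B where AB: "A \<in> C" "B \<in> C" "c = A \<union> u ` A" "d = B \<union> u ` B" by blast
      then show "c \<subseteq> d \<or> d \<subseteq> c" using lin[OF AB(1,2)] by blast
    qed (use CF in blast)
    moreover have "\<Union>((\<lambda>A. A \<union> u ` A) ` C) = \<Union>C \<union> u ` \<Union>C" by auto
    moreover have "\<Union>C \<inter> u ` \<Union>C = {}"
    proof (rule equals0I)
      fix x assume "x \<in> \<Union>C \<inter> u ` \<Union>C"
      then obtain A B y where AB: "A \<in> C" "B \<in> C" "x \<in> A" "y \<in> B" "x = u y" by blast
      then show False using lin[OF AB(1,2)] CF[OF AB(1)] CF[OF AB(2)] by blast
    qed
    ultimately show "\<Union>C \<in> ?F" by simp
  qed
  then obtain A where A: "A \<in> ?F" and max: "\<forall>X\<in>?F. A \<subseteq> X \<longrightarrow> X = A"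
    by (rule bexE)
  have "\<exists>k. u w - k *s w \<in> span (A \<union> u ` A)" if w: "w \<notin> span (A \<union> u ` A)" for w
  proof (rule ccontr)
    assume "\<not> ?thesis"
    then have uw: "u w \<notin> span (insert w (A \<union> u ` A))"
      by (simp add: span_breakdown_eq)
    have "insert w A \<union> u ` insert w A = insert (u w) (insert w (A \<union> u ` A))" by auto
    then have "independent (insert w A \<union> u ` insert w A)"
      using A w uw by (simp add: independent_insertI)
    moreover have "u w \<notin> insert w A" "w \<notin> u ` A"
      using uw w span_base[of "u w" "insert w (A \<union> u ` A)"] span_base[of w "A \<union> u ` A"] by auto
    ultimately have "insert w A \<in> ?F" using A inj_u by (auto simp: inj_eq)
    then have "insert w A = A" by (rule max[rule_format]) (rule subset_insertI)
    then have "w \<in> A" by blast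
    then show False using w span_base[of w "A \<union> u ` A"] by blast
  qed
  then show ?thesis using that A by blast
qed

text \<open>This adapts the fact that a map for which all nonzero vectors are eigenvectors is
  scalar. As \<open>M\<close> is not assumed invariant, there is no induced quotient map, and the
  eigenvalues of \<open>p\<close>, \<open>z\<close> and \<open>p + z\<close> are compared on
  representatives.\<close>

lemma scalar_modulo_or_codim_le_1:
  assumes M: "subspace M" and eig: "\<And>w. w \<notin> M \<Longrightarrow> \<exists>k. u w - k *s w \<in> M"
  obtains z where "span (insert z M) = UNIV" | l where "l \<noteq> 0" "\<And>p. u p - l *s p \<in> M"
proof (cases "\<exists>z. span (insert z M) = UNIV")
  case False
  have spanM: "span M = M" using M by simp
  have "M \<noteq> UNIV" using False by auto
  then obtain z where z: "z \<notin> M" by blast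
  obtain z' where z': "z' \<notin> span (insert z M)" using False by blast
  obtain l where l: "u z - l *s z \<in> M" using eig z by blast
  have out: "u p - l *s p \<in> M" if p: "p \<notin> span (insert z M)" for p
  proof -
    have "p \<notin> M" "p + z \<notin> M"
      using p span_superset[of "insert z M"] span_diff[of "p + z" "insert z M" z] by auto
    then obtain k k' where k: "u p - k *s p \<in> M" "u (p + z) - k' *s (p + z) \<in> M"
      using eig by meson
    have "(u (p + z) - k' *s (p + z)) - (u p - k *s p) - (u z - l *s z) \<in> M"
      by (rule subspace_diff[OF M subspace_diff[OF M k(2,1)] l])
    moreover have "(u (p + z) - k' *s (p + z)) - (u p - k *s p) - (u z - l *s z)
        = (k - k') *s p + (l - k') *s z"
      by (simp add: u.add scale_right_distrib scale_left_diff_distrib)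
    ultimately have comb: "(k - k') *s p + (l - k') *s z \<in> M" by simp
    have "k = k'"
    proof (rule ccontr)
      assume ne: "k \<noteq> k'"
      have "inverse (k - k') *s ((k - k') *s p + (l - k') *s z) \<in> M"
        using comb M by (rule subspace_scale[rotated])
      then have "p - (- (inverse (k - k') * (l - k'))) *s z \<in> M"
        using ne by (simp add: scale_right_distrib)
      then show False using p unfolding span_breakdown_eq spanM by blast
    qed
    moreover have "l = k'"
    proof (rule ccontr)
      assume ne: "l \<noteq> k'"
      have "inverse (l - k') *s ((l - k') *s z) \<in> M"
        by (rule subspace_scale[OF M]) (use comb \<open>k = k'\<close> in simp)
      then show False using ne z by simp
    qed
    ultimately show ?thesis using k by simp
  qed
  \<comment> \<open>A vector inside \<open>span (insert z M)\<close> is the difference of the two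
    outside vectors \<open>p + z'\<close> and \<open>z'\<close>.\<close>
  have all: "u p - l *s p \<in> M" for p
  proof (cases "p \<in> span (insert z M)")
    case True
    then have "p + z' \<notin> span (insert z M)"
      using z' span_diff[of "p + z'" "insert z M" p] by auto
    then have "(u (p + z') - l *s (p + z')) - (u z' - l *s z') \<in> M"
      by (intro subspace_diff[OF M] out z')
    then show ?thesis by (simp add: u.add scale_right_distrib)
  qed (rule out)
  moreover have "l \<noteq> 0"
  proof
    assume "l = 0"
    then show False using all[of "inv u z"] z by simp
  qed
  ultimately show ?thesis using that(2) by blast
qed (use that(1) in blast)

section \<open>The case of an infinite set \<open>A\<close>\<close>

text \<open>The basis is completed by a finite \<open>Z\<^sub>0\<close>, absorbed by the ranked
  injection, and by \<open>Z\<^sub>1\<close>, where \<open>v\<close> can simply be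
  \<open>- l\<close>.\<close>

lemma three_involutions_on_UNIV_decomposed:
  assumes A: "infinite A" "A \<inter> u ` A = {}"
    and Z0: "finite Z\<^sub>0" "Z\<^sub>0 \<inter> (A \<union> u ` A) = {}"
    and Z1: "Z\<^sub>1 \<inter> (A \<union> u ` A \<union> Z\<^sub>0) = {}"
      "\<And>z. z \<in> Z\<^sub>1 \<Longrightarrow> u z - l *s z \<in> span (u ` A)" "l \<noteq> 0"
    and basis: "independent (A \<union> u ` A \<union> Z\<^sub>0 \<union> Z\<^sub>1)" "span (A \<union> u ` A \<union> Z\<^sub>0 \<union> Z\<^sub>1) = UNIV"
  shows "three_involutions_on UNIV"
proof -
  define D where "D = A \<union> u ` A \<union> Z\<^sub>0 \<union> Z\<^sub>1"
  note D = basis[folded D_def]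
  let ?Y = "span (u ` A)" and ?W = "u ` A \<union> Z\<^sub>0"
  have infY: "infinite (u ` A)"
    using A(1) inj_u by (meson finite_imageD inj_on_subset subset_UNIV)
  have "\<exists>t r. finite t \<and> t \<subseteq> A \<union> Z\<^sub>0 \<union> Z\<^sub>1 \<and> u w - (\<Sum>a\<in>t. r a *s a) \<in> ?Y" for w
  proof -
    have "D = (A \<union> Z\<^sub>0 \<union> Z\<^sub>1) \<union> u ` A" unfolding D_def by blast
    then have "u w \<in> span ((A \<union> Z\<^sub>0 \<union> Z\<^sub>1) \<union> u ` A)" using D(2) by simp
    then obtain q y where "u w = q + y" "q \<in> span (A \<union> Z\<^sub>0 \<union> Z\<^sub>1)" "y \<in> ?Y"
      unfolding span_Un[of "A \<union> Z\<^sub>0 \<union> Z\<^sub>1"] by blast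
    moreover then obtain t r where "finite t" "t \<subseteq> A \<union> Z\<^sub>0 \<union> Z\<^sub>1" "q = (\<Sum>a\<in>t. r a *s a)"
      unfolding span_explicit by blast
    ultimately have "finite t \<and> t \<subseteq> A \<union> Z\<^sub>0 \<union> Z\<^sub>1 \<and> u w - (\<Sum>a\<in>t. r a *s a) \<in> ?Y" by simp
    then show ?thesis by blast
  qed
  then obtain t r where t: "\<And>w. finite (t w)" "\<And>w. t w \<subseteq> A \<union> Z\<^sub>0 \<union> Z\<^sub>1"
    and tr: "\<And>w. u w - (\<Sum>a\<in>t w. r w a *s a) \<in> ?Y"
    by metis
  \<comment> \<open>Besides \<open>w\<close>, the rank must dominate \<open>u a\<close> for
    \<open>a\<close> in \<open>t w\<close>: for \<open>a\<close> in \<open>A\<close>, the value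
    \<open>s a = v (s (u a))\<close> is only known once \<open>s (u a)\<close> is.\<close>
  obtain f and rank :: "'b \<Rightarrow> nat" where f: "inj_on f ?W" "f ` ?W \<subseteq> u ` A"
    and rank: "\<And>w n. w \<in> ?W \<Longrightarrow> n \<in> insert w (u ` t w) \<Longrightarrow> rank n < rank (f w)"
    using ranked_injection[OF infY Z0(1), of "\<lambda>w. insert w (u ` t w)"] t(1)
    by (metis finite.insertI finite_imageI)
  \<comment> \<open>\<open>p w\<close> is the part of \<open>u w\<close> off \<open>u\<close>
    A\<open>, so\<close>f w - p w\<open>is\<close>- u
    w\<open>modulo\<close>?Y\<open>, whichever\<close>f w\<open>in\<close>u \<open>A\<close> is
    chosen.\<close>
  define p where "p w = (\<Sum>a\<in>t w. r w a *s a)" for w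
  define v where "v = endo.construct D
     (\<lambda>b. if b \<in> A then u b else if b \<in> Z\<^sub>1 then - (l *s b) else f b - p b)"
  have lv: "lin v" unfolding v_def by (rule endo.linear_construct[OF D(1)])
  have v_A: "v a = u a" if "a \<in> A" for a
  proof -
    have "a \<in> D" using that by (simp add: D_def)
    then show ?thesis using that by (simp add: v_def endo.construct_basis[OF D(1)])
  qed
  have v_Z1: "v z = - (l *s z)" if "z \<in> Z\<^sub>1" for z
  proof -
    have "z \<in> D" "z \<notin> A" using that Z1(1) by (auto simp: D_def)
    then show ?thesis using that by (simp add: v_def endo.construct_basis[OF D(1)])
  qed
  have v_W: "v w = f w - p w" if "w \<in> ?W" for w
  proof -
    have "w \<in> D" "w \<notin> A" "w \<notin> Z\<^sub>1" using that A Z0 Z1 by (auto simp: D_def)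
    then show ?thesis by (simp add: v_def endo.construct_basis[OF D(1)])
  qed
  have D_cases: "b \<in> A \<or> b \<in> Z\<^sub>1 \<or> b \<in> ?W" if "b \<in> D" for b using that by (auto simp: D_def)
  have vY: "v (inv u y) = y" if y: "y \<in> ?Y" for y
  proof -
    obtain q where q: "q \<in> span A" "y = u q" using y by (auto simp: u.span_image)
    have "v q = u q" by (rule endo.linear_eq_on[OF lv linear_u q(1) v_A])
    then show ?thesis using q by simp
  qed
  have vu: "v q + u q \<in> ?Y" for q
  proof (rule lin_in_subspaceI[where f = "\<lambda>p. v p + u p" and B = D])
    fix b assume "b \<in> D"
    then consider "b \<in> A" | "b \<in> Z\<^sub>1" | "b \<in> ?W" using D_cases by blast
    then show "v b + u b \<in> ?Y"
    proof cases
      case 1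
      then have "u b \<in> ?Y" by (intro span_base) auto
      then show ?thesis using 1 by (simp add: v_A span_add)
    next
      case 2
      then show ?thesis using Z1(2) by (simp add: v_Z1)
    next
      case 3
      then have "f b \<in> ?Y" using f(2) by (intro span_base) auto
      then have "f b + (u b - p b) \<in> ?Y" using tr[of b] by (simp only: p_def span_add)
      then show ?thesis using 3 by (simp add: v_W algebra_simps)
    qed
  qed (use D in \<open>auto intro: endo.linear_compose_add lv linear_u\<close>)
  \<comment> \<open>This is the inverse of \<open>v\<close>: with \<open>t = v \<circ> inv u\<close>
    an involution, \<open>v = t \<circ> u\<close> has inverse
    \<open>inv u \<circ> t\<close>.\<close>
  define vi where "vi p = inv u (v (inv u p))" for p
  have lvi: "lin vi"
    unfolding vi_def by (rule lin_comp[OF lin_inv_u lin_comp[OF lv lin_inv_u]])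
  have tt: "v (inv u (v (inv u q))) = q" for q
    using vu[of "inv u q"] by (intro twist_square[OF lv vY]) auto
  have v_vi: "v (vi q) = q" for q unfolding vi_def by (rule tt)
  have vi_v: "vi (v q) = q" for q using tt[of "u q"] unfolding vi_def by simp
  \<comment> \<open>The value of \<open>s\<close> at \<open>f w\<close> is forced: applying \<open>s\<close> to \<open>f w = v w + p w\<close> and using
    \<open>s \<circ> v = v\<inverse> \<circ> s\<close> gives \<open>s (f w) = v\<inverse> (s w) + s (p w)\<close>.\<close>
  define step where "step g y = (if y \<in> f ` ?W then let w = inv_into ?W f y in
     vi (g w) + (\<Sum>a\<in>t w. r w a *s (if a \<in> A then v (g (u a)) else a)) else y)" for g :: "'b \<Rightarrow> 'b" and y
  define \<sigma> where "\<sigma> = wfrec (measure rank) step"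
  \<comment> \<open>On \<open>A\<close> there is no choice: \<open>v a = u a\<close> and the
    relation \<open>v (s (v a)) = s a\<close> determine \<open>s a\<close> from
    \<open>s (u a)\<close>.\<close>
  define s where "s = endo.construct D (\<lambda>b. if b \<in> A then v (\<sigma> (u b)) else \<sigma> b)"
  have ls: "lin s" unfolding s_def by (rule endo.linear_construct[OF D(1)])
  have s_A: "s a = v (\<sigma> (u a))" if "a \<in> A" for a
  proof -
    have "a \<in> D" using that by (simp add: D_def)
    then show ?thesis using that by (simp add: s_def endo.construct_basis[OF D(1)])
  qed
  have s_D: "s b = \<sigma> b" if "b \<in> D" "b \<notin> A" for b
    using that by (simp add: s_def endo.construct_basis[OF D(1)])
  have \<sigma>_rec: "\<sigma> y = step (cut \<sigma> (measure rank) y) y" for y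
    by (rule def_wfrec[OF \<sigma>_def[THEN eq_reflection] wf_measure])
  have \<sigma>_id: "\<sigma> y = y" if "y \<notin> f ` ?W" for y
    using that by (subst \<sigma>_rec) (simp add: step_def)
  have s_Z: "s z = z" if "z \<in> Z\<^sub>0 \<union> Z\<^sub>1" for z
  proof -
    have "z \<in> D" "z \<notin> A" "z \<notin> f ` ?W" using that f(2) Z0 Z1 by (auto simp: D_def)
    then show ?thesis using s_D \<sigma>_id by simp
  qed
  have s_Y: "s (u a) = \<sigma> (u a)" if "a \<in> A" for a
    using that A(2) by (intro s_D) (auto simp: D_def)
  have W_D: "w \<in> D" "w \<notin> A" if "w \<in> ?W" for w
    using that A Z0 by (auto simp: D_def)
  have fW: "f w \<in> ?W" if "w \<in> ?W" for w using f(2) that by blast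
  have s_f: "s (f w) = vi (s w) + s (p w)" if w: "w \<in> ?W" for w
  proof -
    let ?c = "cut \<sigma> (measure rank) (f w)"
    have c: "?c n = \<sigma> n" if "n \<in> insert w (u ` t w)" for n
      using rank[OF w that] by (intro cut_apply) simp
    have "s (f w) = \<sigma> (f w)" using W_D[OF fW[OF w]] by (rule s_D)
    also have "\<dots> = step ?c (f w)" by (rule \<sigma>_rec)
    also have "\<dots> = vi (?c w) + (\<Sum>a\<in>t w. r w a *s (if a \<in> A then v (?c (u a)) else a))"
      using w by (simp add: step_def inv_into_f_f[OF f(1) w] Let_def del: Un_iff)
    also have "?c w = s w" using c[of w] s_D W_D[OF w] by simp
    also have "(\<Sum>a\<in>t w. r w a *s (if a \<in> A then v (?c (u a)) else a)) = (\<Sum>a\<in>t w. r w a *s s a)"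
    proof (rule sum.cong)
      fix a assume a: "a \<in> t w"
      then show "r w a *s (if a \<in> A then v (?c (u a)) else a) = r w a *s s a"
        using c[of "u a"] s_A[of a] s_Z[of a] t(2)[of w] by auto
    qed simp
    also have "\<dots> = s (p w)"
      by (simp add: p_def endo.linear_sum[OF ls] endo.linear_scale[OF ls])
    finally show ?thesis .
  qed
  have vsv: "v (s (v q)) = s q" for q
  proof (rule endo.linear_eq_on[OF lin_comp[OF lv lin_comp[OF ls lv]] ls, of q D])
    fix b assume "b \<in> D"
    then consider "b \<in> A" | "b \<in> Z\<^sub>1" | "b \<in> ?W" using D_cases by blast
    then show "v (s (v b)) = s b"
    proof cases
      case 1
      then show ?thesis by (simp add: v_A s_Y s_A)
    next
      case 2
      then show ?thesis
        by (simp add: v_Z1 s_Z endo.linear_neg[OF lv] endo.linear_neg[OF ls] endo.linear_scale[OF lv]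
            endo.linear_scale[OF ls] scalar_square[OF Z1(3)])
    next
      case 3
      then have "s (v b) = vi (s b)" by (simp add: v_W endo.linear_diff[OF ls] s_f)
      then show ?thesis by (simp add: v_vi)
    qed
  qed (use D(2) in simp)
  have sv: "s (v q) = vi (s q)" for q using vsv[of q] vi_v by metis
  have svi: "s (vi q) = v (s q)" for q using vsv[of "vi q"] by (simp add: v_vi)
  \<comment> \<open>Since \<open>s \<circ> s\<close> commutes with \<open>v\<close>, being fixed by
    it passes between \<open>q\<close> and \<open>v q\<close>.\<close>
  have ssv: "s (s (v q)) = v (s (s q))" for q by (simp add: sv svi)
  have ss_A: "s (s a) = a" if "a \<in> A" "s (s (u a)) = u a" for a
  proof -
    have "v (s (s a)) = v a" using that by (simp add: v_A flip: ssv)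
    then show ?thesis using vi_v by metis
  qed
  \<comment> \<open>Induction on rank: \<open>f w = v w + p w\<close>, where \<open>w\<close> and
    the vectors \<open>u a\<close> behind \<open>p w\<close> have smaller rank.\<close>
  have ss_W: "s (s y) = y" if "y \<in> ?W" for y
    using that
  proof (induction y rule: measure_induct_rule[of rank])
    case (less y)
    show ?case
    proof (cases "y \<in> f ` ?W")
      case True
      then obtain w where w: "w \<in> ?W" "y = f w" by blast
      have "s (s a) = a" if a: "a \<in> t w" for a
      proof (cases "a \<in> A")
        case True
        have "rank (u a) < rank y" using rank[OF w(1), of "u a"] a w(2) by simp
        then have "s (s (u a)) = u a" by (rule less.IH) (use True in blast)
        then show ?thesis by (rule ss_A[OF True])
      next
        case False
        then show ?thesis using a t(2)[of w] s_Z[of a] by auto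
      qed
      then have "s (s (p w)) = p w"
        by (simp add: p_def endo.linear_sum[OF ls] endo.linear_scale[OF ls])
      moreover have "s (s w) = w" using less.IH[of w] rank[OF w(1), of w] w by simp
      moreover have "f w = v w + p w" using v_W[OF w(1)] by simp
      ultimately show ?thesis using w(2) by (simp add: endo.linear_add[OF ls] ssv)
    next
      case False
      then have "s y = y" using s_D W_D[OF less.prems] \<sigma>_id by simp
      then show ?thesis by simp
    qed
  qed
  have ss: "s (s q) = q" for q
  proof (rule endo.linear_eq_on[OF lin_comp[OF ls ls] linear_ident, of q D])
    fix b assume "b \<in> D"
    then consider "b \<in> A" | "b \<in> Z\<^sub>1" | "b \<in> ?W" using D_cases by blast
    then show "s (s b) = b" by cases (auto intro: ss_A ss_W simp: s_Z)
  qed (use D in simp)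
  show ?thesis
    by (rule three_involutions_onI[where v = v and s = s and Y = ?Y])
      (use lv ls vY vu vsv ss bij_u in \<open>auto simp: bij_is_surj\<close>)
qed

section \<open>Assembling the cases\<close>

lemma three_involutions_on_UNIV:
  assumes inf: "infinite_dimensional"
  shows "three_involutions_on UNIV"
proof -
  have no_finite_span: "span B \<noteq> UNIV" if "finite B" for B
  proof
    assume "span B = UNIV"
    obtain B' where B': "B' \<subseteq> B" "independent B'" "B \<subseteq> span B'"
      by (rule maximal_independent_subset)
    then have "span B' = UNIV" using span_minimal[of B "span B'"] \<open>span B = UNIV\<close> by auto
    moreover have "finite B'" using B'(1) that by (rule finite_subset)
    ultimately show False using inf B'(2) unfolding infinite_dimensional_def by blast
  qed
  obtain A where A: "A \<inter> u ` A = {}" "independent (A \<union> u ` A)"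
    and eig: "\<And>w. w \<notin> span (A \<union> u ` A) \<Longrightarrow> \<exists>k. u w - k *s w \<in> span (A \<union> u ` A)"
    by (rule maximal_disjoint_image) (rule that)
  let ?M = "span (A \<union> u ` A)" and ?Y = "span (u ` A)"
  consider z where "span (insert z ?M) = UNIV" | l where "l \<noteq> 0" "\<And>p. u p - l *s p \<in> ?M"
    using scalar_modulo_or_codim_le_1[OF subspace_span eig] by blast
  then show ?thesis
  proof cases
    case 1
    have "insert z ?M \<subseteq> span (insert z (A \<union> u ` A))"
      using span_mono[of "A \<union> u ` A" "insert z (A \<union> u ` A)"] by (auto intro: span_base)
    then have span: "span (insert z (A \<union> u ` A)) = UNIV"
      using 1 span_minimal[OF _ subspace_span] by (metis top.extremum_uniqueI)
    then have infA: "infinite A" using no_finite_span[of "insert z (A \<union> u ` A)"] by auto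
    obtain B where B: "A \<union> u ` A \<subseteq> B" "B \<subseteq> insert z (A \<union> u ` A)" "independent B"
      "insert z (A \<union> u ` A) \<subseteq> span B"
      using maximal_independent_subset_extend[of "A \<union> u ` A" "insert z (A \<union> u ` A)"] A(2) by blast
    then have "span B = UNIV" using span span_minimal[OF B(4)] by auto
    moreover have "A \<union> u ` A \<union> (B - (A \<union> u ` A)) \<union> {} = B" using B(1) by blast
    \<comment> \<open>The remainder is at most \<open>{z}\<close> and serves as
      \<open>Z\<^sub>0\<close>; with \<open>Z\<^sub>1\<close> empty, the scalar 1 passed below is a
      dummy.\<close>
    moreover have "finite (B - (A \<union> u ` A))" by (rule finite_subset[of _ "{z}"]) (use B(2) in auto)
    ultimately show ?thesis
      using three_involutions_on_UNIV_decomposed[OF infA A(1), of "B - (A \<union> u ` A)" "{}" 1] B(3) by auto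
  next
    case 2
    show ?thesis
    proof (cases "finite A")
      case True
      then have fin: "finite (A \<union> u ` A)" by simp
      show ?thesis
      proof (rule three_involutions_on_finite_rank[OF 2(1)])
        fix B assume "independent B" "B \<subseteq> (\<lambda>p. u p - l *s p) ` UNIV"
        then show "finite B \<and> card B \<le> card (A \<union> u ` A)"
          using 2(2) by (intro independent_span_bound[OF fin]) auto
      qed auto
    next
      case infA: False
      \<comment> \<open>The remainder must satisfy \<open>u = l\<close> modulo \<open>?Y\<close>,
        not just modulo \<open>?M\<close>, so the basis is completed by vectors of
        \<open>K\<close>.\<close>
      define K where "K = {p. u p - l *s p \<in> ?Y}"
      obtain B where B: "A \<union> u ` A \<subseteq> B" "B \<subseteq> A \<union> u ` A \<union> K" "independent B" "A \<union> u ` A \<union> K \<subseteq> span B"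
        using maximal_independent_subset_extend[of "A \<union> u ` A" "A \<union> u ` A \<union> K"] A(2) by blast
      have M_B: "?M \<subseteq> span B" by (rule span_mono[OF B(1)])
      have "p \<in> span B" for p
      proof -
        \<comment> \<open>Solving \<open>u m = u p - l *s p\<close> gives \<open>m\<close> in
          \<open>?M\<close>. Subtracting its \<open>?Y\<close>-component \<open>y\<close> from
          \<open>p\<close> leaves the error \<open>u x + l *s y\<close>, which is in
          \<open>?Y\<close>.\<close>
        define m where "m = inv u (u p - l *s p)"
        have um: "u m = u p - l *s p" by (simp add: m_def)
        have "l *s m = u m - (u m - l *s m)" by simp
        then have "l *s m \<in> ?M" using 2(2)[of p] 2(2)[of m] um by (metis span_diff)
        then have "inverse l *s (l *s m) \<in> ?M" by (rule span_scale)
        then have "m \<in> ?M" using 2(1) by simp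
        then obtain x y where xy: "m = x + y" "x \<in> span A" "y \<in> ?Y"
          unfolding span_Un by blast
        have "u x \<in> ?Y" using xy(2) by (simp add: u.span_image)
        moreover have "u (p - y) - l *s (p - y) = u x + l *s y"
          using um xy(1) by (simp add: u.diff u.add scale_right_diff_distrib algebra_simps)
        ultimately have "p - y \<in> K"
          using xy(3) by (simp add: K_def span_add span_scale)
        moreover have "y \<in> span B" using xy(3) span_mono[of "u ` A" "A \<union> u ` A"] M_B by auto
        ultimately have "(p - y) + y \<in> span B" using B(4) by (intro span_add) auto
        then show ?thesis by simp
      qed
      then have "span B = UNIV" by auto
      moreover have "A \<union> u ` A \<union> {} \<union> (B - (A \<union> u ` A)) = B" using B(1) by blast
      moreover have "u z - l *s z \<in> ?Y" if "z \<in> B - (A \<union> u ` A)" for z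
        using that B(2) by (auto simp: K_def)
      ultimately show ?thesis
        using three_involutions_on_UNIV_decomposed[OF infA A(1), of "{}" "B - (A \<union> u ` A)" l] B(3) 2(1) by auto
    qed
  qed
qed

end

section \<open>Fields with at most three elements\<close>

text \<open>Otherwise \<open>0\<close>, \<open>1\<close>, \<open>l\<close> and \<open>l * l\<close>
  would be four distinct elements.\<close>

lemma square_eq_1_if_card_le_3:
  fixes l :: "'k::field"
  assumes "finite (UNIV :: 'k set)" "card (UNIV :: 'k set) \<le> 3" "l \<noteq> 0"
  shows "l * l = 1"
proof (rule ccontr)
  assume ne: "l * l \<noteq> 1"
  then have "l \<noteq> 1" "l * l \<noteq> l" "l * l \<noteq> 0" using assms(3) by auto
  then have "card {0, 1, l, l * l} = 4" using ne assms(3) by auto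
  then show False using card_mono[OF assms(1), of "{0, 1, l, l * l}"] assms(2) by simp
qed

theorem corollary1p7:
  fixes scale :: "'k::field \<Rightarrow> 'v::ab_group_add \<Rightarrow> 'v"
    and u :: "'v \<Rightarrow> 'v"
  assumes "finite (UNIV :: 'k set)"
    and "card (UNIV :: 'k set) \<le> 3"
    and "vector_space scale"
    and "vector_space.infinite_dimensional scale"
    and "vector_space.automorphism scale u"
  shows "\<exists>a b c. vector_space.involution scale a \<and> vector_space.involution scale b
    \<and> vector_space.involution scale c \<and> u = a \<circ> b \<circ> c"
proof -
  interpret vector_space scale by fact
  have u: "Vector_Spaces.linear scale scale u" "bij u"
    using assms(5) by (auto simp: automorphism_def)
  interpret involutive_scalars_automorphism scale u
    by (intro involutive_scalars_automorphism.intro involutive_scalars_automorphism_axioms.intro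
        assms(3) u square_eq_1_if_card_le_3 assms(1,2))
  obtain a b c where "involutive_on UNIV a" "involutive_on UNIV b" "involutive_on UNIV c"
    "\<forall>p. u p = a (b (c p))"
    using three_involutions_on_UNIV[OF assms(4)] unfolding three_involutions_on_def by auto
  then show ?thesis
    by (intro exI[of _ a] exI[of _ b] exI[of _ c])
      (auto simp: involution_def involutive_on_def fun_eq_iff)
qed

end
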